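(* Let $G$ be a finite almost simple group, let $K$ be a $2$-closed group with $G^*\le K\le\mathrm{Sym}(G)$, and suppose $K$ is of normal type. Let $U/L$ be the principal $K$-section of $G$. Then $K^U\le D(2,U)$.
   Context: $G$ is almost simple if $\mathrm{soc}(G)$ is a nonabelian simple group. For a group $V$ and $L\le V$, $L_{left}$, $L_{right}\le\mathrm{Sym}(V)$ are the groups of permutations $g\mapsto xg$, $g\mapsto gx$ ($x\in L$), $L^*=L_{left}L_{right}$; $D(2,V)\le\mathrm{Sym}(V)$ is generated by $N_{\mathrm{Sym}(V)}(V_{right})$ and $x\mapsto x^{-1}$. $K$ is $2$-closed if every permutation preserving each orbit of $K$ on $G\times G$ lies in $K$. For $H\subseteq G$, $K^H$ is the group induced on $H$ by the setwise stabilizer of $H$ in $K$. For an imprimitivity system $\mathfrak L$, $K_{\mathfrak L}$ is the subgroup of $K$ fixing each block setwise and $(K_{\mathfrak L})^Z$ its restriction to a union $Z$ of blocks. Principal section: the minimal block $L$ is the intersection of all blocks of imprimitivity of $K$ containing $1$ with more than one element (a normal subgroup of $G$); $\mathfrak L$ is the imprimitivity system containing $L$; for $X,X'\in\mathfrak L$, $X\sim X'$ if both restrictions $(K_{\mathfrak L})^{X\cup X'}\to(K_{\mathfrak L})^X$, $(K_{\mathfrak L})^{X\cup X'}\to(K_{\mathfrak L})^{X'}$ are isomorphisms; $U$ is the union of the $\sim$-class of $L$ (a normal subgroup with $L\trianglelefteq U\trianglelefteq G$). $K$ is of normal type if $L=\mathrm{soc}(L)$ and $K^L\le D(2,L)$.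 *)

theory Defs
  imports "HOL-Algebra.Algebra" "HOL-Algebra.Bij"
begin

text \<open>
  Sym(V) is rendered by the library group \<^term>\<open>BijGroup V\<close>, whose elements are functions that are
  extensional on \<open>V\<close>; the restriction of a permutation to a subset \<open>H\<close> is accordingly
  \<^term>\<open>restrict k H\<close>.  Subgroups of groups are carrier subsets, and a subgroup regarded as a
  group in its own right is obtained by updating the carrier.
\<close>

section \<open>Socle and almost simple groups\<close>

definition minimal_normal :: "('a, 'b) monoid_scheme \<Rightarrow> 'a set \<Rightarrow> bool" where
  "minimal_normal G N \<longleftrightarrow>
     N \<lhd> G \<and> N \<noteq> {\<one>\<^bsub>G\<^esub>} \<and> (\<forall>M. M \<lhd> G \<and> M \<subseteq> N \<longrightarrow> M = {\<one>\<^bsub>G\<^esub>} \<or> M = N)"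

definition socle :: "('a, 'b) monoid_scheme \<Rightarrow> 'a set" where
  "socle G = generate G (\<Union>{N. minimal_normal G N})"

definition almost_simple :: "('a, 'b) monoid_scheme \<Rightarrow> bool" where
  "almost_simple G \<longleftrightarrow> group G \<and>
     simple_group (G\<lparr>carrier := socle G\<rparr>) \<and> \<not> comm_group (G\<lparr>carrier := socle G\<rparr>)"

section \<open>Translations and the group D(2,V)\<close>

definition left_translations :: "('a, 'b) monoid_scheme \<Rightarrow> 'a set \<Rightarrow> ('a \<Rightarrow> 'a) set" where
  "left_translations V L = (\<lambda>x. \<lambda>g\<in>carrier V. x \<otimes>\<^bsub>V\<^esub> g) ` L"

definition right_translations :: "('a, 'b) monoid_scheme \<Rightarrow> 'a set \<Rightarrow> ('a \<Rightarrow> 'a) set" where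
  "right_translations V L = (\<lambda>x. \<lambda>g\<in>carrier V. g \<otimes>\<^bsub>V\<^esub> x) ` L"

definition star_group :: "('a, 'b) monoid_scheme \<Rightarrow> 'a set \<Rightarrow> ('a \<Rightarrow> 'a) set" where
  "star_group V L = left_translations V L <#>\<^bsub>BijGroup (carrier V)\<^esub> right_translations V L"

definition D2 :: "('a, 'b) monoid_scheme \<Rightarrow> ('a \<Rightarrow> 'a) set" where
  "D2 V = generate (BijGroup (carrier V))
     (normalizer (BijGroup (carrier V)) (right_translations V (carrier V))
       \<union> {\<lambda>x\<in>carrier V. inv\<^bsub>V\<^esub> x})"

section \<open>Permutation groups\<close>

definition two_closed :: "'a set \<Rightarrow> ('a \<Rightarrow> 'a) set \<Rightarrow> bool" where
  "two_closed \<Omega> K \<longleftrightarrow>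
     (\<forall>f\<in>Bij \<Omega>.
        (\<forall>R\<in>orbits (BijGroup \<Omega>\<lparr>carrier := K\<rparr>) (\<Omega> \<times> \<Omega>) (\<lambda>k. map_prod k k). map_prod f f ` R = R)
        \<longrightarrow> f \<in> K)"

definition restr :: "('a \<Rightarrow> 'a) set \<Rightarrow> 'a set \<Rightarrow> ('a \<Rightarrow> 'a) set" where
  "restr K Z = (\<lambda>k. restrict k Z) ` K"

definition induced :: "('a \<Rightarrow> 'a) set \<Rightarrow> 'a set \<Rightarrow> ('a \<Rightarrow> 'a) set" where
  "induced K H = restr {k \<in> K. k ` H = H} H"

definition is_block :: "'a set \<Rightarrow> ('a \<Rightarrow> 'a) set \<Rightarrow> 'a set \<Rightarrow> bool" where
  "is_block \<Omega> K B \<longleftrightarrow>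
     B \<subseteq> \<Omega> \<and> B \<noteq> {} \<and> (\<forall>k\<in>K. k ` B = B \<or> k ` B \<inter> B = {})"

definition block_system :: "('a \<Rightarrow> 'a) set \<Rightarrow> 'a set \<Rightarrow> 'a set set" where
  "block_system K B = (\<lambda>k. k ` B) ` K"

definition block_kernel :: "('a \<Rightarrow> 'a) set \<Rightarrow> 'a set set \<Rightarrow> ('a \<Rightarrow> 'a) set" where
  "block_kernel K \<L> = {k \<in> K. \<forall>Y\<in>\<L>. k ` Y = Y}"

definition linked :: "('a \<Rightarrow> 'a) set \<Rightarrow> 'a set set \<Rightarrow> ('a set \<times> 'a set) set" where
  "linked K \<L> = {(Y, Y'). Y \<in> \<L> \<and> Y' \<in> \<L> \<and>
     (\<forall>Z\<in>{Y, Y'}.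
        (\<lambda>f. restrict f Z)
          \<in> iso (BijGroup (Y \<union> Y')\<lparr>carrier := restr (block_kernel K \<L>) (Y \<union> Y')\<rparr>)
                (BijGroup Z\<lparr>carrier := restr (block_kernel K \<L>) Z\<rparr>))}"

section \<open>The principal section\<close>

text \<open>The whole group counts as a block, so the minimal block is \<open>G\<close> itself if \<open>K\<close> is primitive.\<close>

definition minimal_block :: "('a, 'b) monoid_scheme \<Rightarrow> ('a \<Rightarrow> 'a) set \<Rightarrow> 'a set" where
  "minimal_block G K = \<Inter>{B. is_block (carrier G) K B \<and> \<one>\<^bsub>G\<^esub> \<in> B \<and> B \<noteq> {\<one>\<^bsub>G\<^esub>}}"

definition principal_upper :: "('a, 'b) monoid_scheme \<Rightarrow> ('a \<Rightarrow> 'a) set \<Rightarrow> 'a set" where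
  "principal_upper G K =
     \<Union>(linked K (block_system K (minimal_block G K)) `` {minimal_block G K})"

definition normal_type :: "('a, 'b) monoid_scheme \<Rightarrow> ('a \<Rightarrow> 'a) set \<Rightarrow> bool" where
  "normal_type G K \<longleftrightarrow>
     (let L = minimal_block G K; GL = G\<lparr>carrier := L\<rparr>
      in L = socle GL \<and> induced K L \<subseteq> D2 GL)"

end

theory Submission
  imports Defs
begin

text \<open>
  Every block containing \<open>1\<close> is a normal subgroup, so the minimal block \<open>L\<close> contains the socle and
  has trivial centralizer in \<open>G\<close>. Let \<open>k \<in> K\<close> preserve \<open>U\<close>; composing with a translation we may
  assume \<open>k 1 = 1\<close>. Since \<open>k\<close> restricted to \<open>L\<close> lies in \<open>D(2,L)\<close>, it is an automorphism or an
  anti-automorphism of \<open>L\<close>, so conjugation by \<open>k\<close> takes \<open>x \<mapsto> a x b\<close> (\<open>a, b \<in> L\<close>) to a permutation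
  which agrees on \<open>L\<close> with another map \<open>x \<mapsto> a' x b'\<close>. Both lie in the kernel of \<open>K\<close> on the blocks,
  which acts faithfully on \<open>L\<close> once restricted to \<open>U\<close>, so they agree on \<open>U\<close>. Thus \<open>k\<close>, or its
  composition with inversion, satisfies \<open>\<phi> (a x b) = \<phi> a \<cdot> \<phi> x \<cdot> \<phi> b\<close> for \<open>x \<in> U\<close>; comparing
  the conjugation actions on \<open>L\<close>, the trivial centralizer makes \<open>\<phi>\<close> multiplicative on \<open>U\<close>.
\<close>

section \<open>The group D(2,V)\<close>

text \<open>
  \<open>D(2,V)\<close> consists of the bijections that preserve the ternary operation \<open>x y\<^sup>-\<^sup>1 z\<close> up to
  reversal (\<open>D2_iff\<close>). Unlike multiplicativity, this condition does not refer to the identity.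
\<close>

definition heap_hom :: "('a, 'b) monoid_scheme \<Rightarrow> ('a \<Rightarrow> 'a) \<Rightarrow> bool" where
  "heap_hom V f \<longleftrightarrow> (\<forall>x\<in>carrier V. \<forall>y\<in>carrier V. \<forall>z\<in>carrier V.
     f (x \<otimes>\<^bsub>V\<^esub> inv\<^bsub>V\<^esub> y \<otimes>\<^bsub>V\<^esub> z) = f x \<otimes>\<^bsub>V\<^esub> inv\<^bsub>V\<^esub> (f y) \<otimes>\<^bsub>V\<^esub> f z)"

definition heap_antihom :: "('a, 'b) monoid_scheme \<Rightarrow> ('a \<Rightarrow> 'a) \<Rightarrow> bool" where
  "heap_antihom V f \<longleftrightarrow> (\<forall>x\<in>carrier V. \<forall>y\<in>carrier V. \<forall>z\<in>carrier V.
     f (x \<otimes>\<^bsub>V\<^esub> inv\<^bsub>V\<^esub> y \<otimes>\<^bsub>V\<^esub> z) = f z \<otimes>\<^bsub>V\<^esub> inv\<^bsub>V\<^esub> (f y) \<otimes>\<^bsub>V\<^esub> f x)"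

section \<open>Permutations of a set as extensional bijections\<close>

lemma Bij_closed: "f \<in> Bij S \<Longrightarrow> x \<in> S \<Longrightarrow> f x \<in> S"
  using Bij_imp_funcset by blast

lemma Bij_image: "f \<in> Bij S \<Longrightarrow> f ` S = S"
  by (simp add: Bij_def bij_betw_def)

lemma Bij_inj_on: "f \<in> Bij S \<Longrightarrow> inj_on f S"
  by (simp add: Bij_def bij_betw_def)

lemma Bij_eqI: "f \<in> Bij S \<Longrightarrow> g \<in> Bij S \<Longrightarrow> (\<And>x. x \<in> S \<Longrightarrow> f x = g x) \<Longrightarrow> f = g"
  by (meson Bij_imp_extensional extensionalityI)

lemma carrier_BijGroup [simp]: "carrier (BijGroup S) = Bij S"
  by (simp add: BijGroup_def)

lemma mult_BijGroup:
  "f \<in> Bij S \<Longrightarrow> g \<in> Bij S \<Longrightarrow> f \<otimes>\<^bsub>BijGroup S\<^esub> g = compose S f g"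
  by (simp add: BijGroup_def)

lemma mult_BijGroup_apply:
  "f \<in> Bij S \<Longrightarrow> g \<in> Bij S \<Longrightarrow> x \<in> S \<Longrightarrow> (f \<otimes>\<^bsub>BijGroup S\<^esub> g) x = f (g x)"
  by (simp add: mult_BijGroup compose_eq)

lemma inv_BijGroup_closed: "f \<in> Bij S \<Longrightarrow> inv\<^bsub>BijGroup S\<^esub> f \<in> Bij S"
  using group.inv_closed[OF group_BijGroup] by fastforce

lemma inv_BijGroup_left: "f \<in> Bij S \<Longrightarrow> x \<in> S \<Longrightarrow> (inv\<^bsub>BijGroup S\<^esub> f) (f x) = x"
  by (simp add: inv_BijGroup Bij_closed Bij_inj_on)

lemma inv_BijGroup_right: "f \<in> Bij S \<Longrightarrow> x \<in> S \<Longrightarrow> f ((inv\<^bsub>BijGroup S\<^esub> f) x) = x"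
  by (simp add: inv_BijGroup Bij_image f_inv_into_f)

lemma (in group) left_translation_Bij:
  "a \<in> carrier G \<Longrightarrow> (\<lambda>x\<in>carrier G. a \<otimes> x) \<in> Bij (carrier G)"
  unfolding Bij_def by (auto intro!: bij_betw_byWitness[where f' = "\<lambda>x. inv a \<otimes> x"] simp: m_assoc[symmetric])

lemma (in group) right_translation_Bij:
  "a \<in> carrier G \<Longrightarrow> (\<lambda>x\<in>carrier G. x \<otimes> a) \<in> Bij (carrier G)"
  unfolding Bij_def by (auto intro!: bij_betw_byWitness[where f' = "\<lambda>x. x \<otimes> inv a"] simp: m_assoc)

lemma (in group) inversion_Bij: "(\<lambda>x\<in>carrier G. inv x) \<in> Bij (carrier G)"
  unfolding Bij_def by (auto intro!: bij_betw_byWitness[where f' = "\<lambda>x. inv x"])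

text \<open>Two reversals compose to a map that keeps the order of the factors, a mixed pair to one
  that reverses it, and inverses keep the kind. This bounds the group generated in \<open>D2\<close>
  from above.\<close>

lemma (in group) heap_subgroup:
  "subgroup {f \<in> Bij (carrier G). heap_hom G f \<or> heap_antihom G f} (BijGroup (carrier G))"
    (is "subgroup ?H ?B")
proof (rule group.subgroupI[OF group_BijGroup])
  show "?H \<subseteq> carrier ?B" by auto
  have "(\<lambda>x\<in>carrier G. x) \<in> ?H"
    by (auto simp: heap_hom_def id_Bij)
  then show "?H \<noteq> {}" by blast
next
  fix f assume f: "f \<in> ?H"
  then have fB: "f \<in> Bij (carrier G)" by simp
  let ?g = "inv\<^bsub>?B\<^esub> f"
  have gB: "?g \<in> Bij (carrier G)" using fB by (rule inv_BijGroup_closed)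
  have eqI: "?g w = u" if "u \<in> carrier G" "f u = w" for u w
    using inv_BijGroup_left[OF fB that(1)] that(2) by simp
  have "heap_hom G ?g" if "heap_hom G f"
    unfolding heap_hom_def
  proof (intro ballI, rule eqI)
    fix x y z assume "x \<in> carrier G" "y \<in> carrier G" "z \<in> carrier G"
    then show "f (?g x \<otimes> inv ?g y \<otimes> ?g z) = x \<otimes> inv y \<otimes> z"
      using that by (simp add: heap_hom_def Bij_closed[OF gB] inv_BijGroup_right[OF fB])
  qed (simp add: Bij_closed[OF gB])
  moreover have "heap_antihom G ?g" if "heap_antihom G f"
    unfolding heap_antihom_def
  proof (intro ballI, rule eqI)
    fix x y z assume "x \<in> carrier G" "y \<in> carrier G" "z \<in> carrier G"
    then show "f (?g z \<otimes> inv ?g y \<otimes> ?g x) = x \<otimes> inv y \<otimes> z"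
      using that by (simp add: heap_antihom_def Bij_closed[OF gB] inv_BijGroup_right[OF fB])
  qed (simp add: Bij_closed[OF gB])
  ultimately show "?g \<in> ?H" using f gB by auto
next
  fix f g assume f: "f \<in> ?H" and g: "g \<in> ?H"
  then have B: "f \<in> Bij (carrier G)" "g \<in> Bij (carrier G)" by simp_all
  then have fgB: "f \<otimes>\<^bsub>?B\<^esub> g \<in> Bij (carrier G)" by (simp add: mult_BijGroup compose_Bij)
  have "heap_hom G (f \<otimes>\<^bsub>?B\<^esub> g) \<or> heap_antihom G (f \<otimes>\<^bsub>?B\<^esub> g)"
    using f g by (auto simp: heap_hom_def heap_antihom_def mult_BijGroup_apply Bij_closed)
  with fgB show "f \<otimes>\<^bsub>?B\<^esub> g \<in> ?H" by simp
qed

text \<open>The case \<open>y = \<one>\<close> of the heap identity; if \<open>f\<close> fixes the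
  identity, the middle factor drops out and \<open>f\<close> is multiplicative.\<close>

lemma (in group) heap_hom_translate:
  assumes "heap_hom G f" "x \<in> carrier G" "r \<in> carrier G"
  shows "f (x \<otimes> r) = f x \<otimes> inv (f \<one>) \<otimes> f r"
  using assms(1)[unfolded heap_hom_def, rule_format, OF assms(2) one_closed assms(3)] assms(2) by simp

lemma (in group) heap_antihom_translate:
  assumes "heap_antihom G f" "x \<in> carrier G" "r \<in> carrier G"
  shows "f (x \<otimes> r) = f r \<otimes> inv (f \<one>) \<otimes> f x"
  using assms(1)[unfolded heap_antihom_def, rule_format, OF assms(2) one_closed assms(3)] assms(2) by simp

text \<open>Conjugation by \<open>f\<close> turns right translation by \<open>r\<close> into that by
  \<open>s\<close> exactly when \<open>f (x \<otimes> r) = f x \<otimes> s\<close> for all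
  \<open>x\<close>. Eliminating \<open>s\<close> between two values of \<open>x\<close> gives the
  heap identity. This is the holomorph of the group in heap form.\<close>

lemma (in group) normalizer_right_translations_iff:
  "f \<in> normalizer (BijGroup (carrier G)) (right_translations G (carrier G))
    \<longleftrightarrow> f \<in> Bij (carrier G) \<and> heap_hom G f"
proof -
  let ?B = "BijGroup (carrier G)" and ?R = "right_translations G (carrier G)"
  define \<rho> where "\<rho> r = (\<lambda>x\<in>carrier G. x \<otimes> r)" for r
  have \<rho>B: "\<rho> r \<in> Bij (carrier G)" if "r \<in> carrier G" for r
    unfolding \<rho>_def using that by (rule right_translation_Bij)
  have R: "?R = \<rho> ` carrier G"
    by (simp add: right_translations_def \<rho>_def)
  define cj where "cj f r = f \<otimes>\<^bsub>?B\<^esub> \<rho> r \<otimes>\<^bsub>?B\<^esub> inv\<^bsub>?B\<^esub> f" for f r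
  have cjB: "cj f r \<in> Bij (carrier G)" if "f \<in> Bij (carrier G)" "r \<in> carrier G" for f r
    using that \<rho>B by (simp add: cj_def mult_BijGroup compose_Bij inv_BijGroup_closed)
  have cj_apply: "cj f r (f x) = f (x \<otimes> r)"
    if "f \<in> Bij (carrier G)" "r \<in> carrier G" "x \<in> carrier G" for f r x
    using that \<rho>B by (simp add: cj_def mult_BijGroup compose_Bij inv_BijGroup_closed compose_eq
        Bij_closed inv_BijGroup_left) (simp add: \<rho>_def)
  have norm_iff: "f \<in> normalizer ?B ?R \<longleftrightarrow> f \<in> Bij (carrier G) \<and> cj f ` carrier G = \<rho> ` carrier G" for f
  proof -
    have "?R \<subseteq> Bij (carrier G)" using \<rho>B R by auto
    moreover have "f <#\<^bsub>?B\<^esub> ?R #>\<^bsub>?B\<^esub> inv\<^bsub>?B\<^esub> f = cj f ` carrier G"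
      by (auto simp: R l_coset_def r_coset_def cj_def)
    ultimately show ?thesis by (auto simp: normalizer_def stabilizer_def R)
  qed
  \<comment> \<open>The translating element \<open>s\<close> is read off at
    \<open>x = \<one>\<close>, where \<open>f r = f \<one> \<otimes> s\<close>.\<close>
  have cj_heap: "cj f r = \<rho> (inv (f \<one>) \<otimes> f r)"
    if f: "f \<in> Bij (carrier G)" "heap_hom G f" and r: "r \<in> carrier G" for f r
  proof (rule Bij_eqI)
    show "cj f r \<in> Bij (carrier G)" using f r by (simp add: cjB)
    show "\<rho> (inv (f \<one>) \<otimes> f r) \<in> Bij (carrier G)"
      using f r by (simp add: \<rho>B Bij_closed)
    fix y assume "y \<in> carrier G"
    then obtain x where "x \<in> carrier G" "y = f x"
      using Bij_image[OF f(1)] by blast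
    then show "cj f r y = \<rho> (inv (f \<one>) \<otimes> f r) y"
      using f r by (simp add: cj_apply heap_hom_translate \<rho>_def Bij_closed m_assoc)
  qed
  show ?thesis
  proof
    assume "f \<in> normalizer ?B ?R"
    then have fB: "f \<in> Bij (carrier G)" and N: "cj f ` carrier G = \<rho> ` carrier G"
      by (auto simp: norm_iff)
    have "f (x \<otimes> inv y \<otimes> z) = f x \<otimes> inv (f y) \<otimes> f z"
      if c: "x \<in> carrier G" "y \<in> carrier G" "z \<in> carrier G" for x y z
    proof -
      \<comment> \<open>With \<open>r = inv y \<otimes> z\<close>, multiplying \<open>x\<close> by
        \<open>r\<close> gives the heap product and multiplying \<open>y\<close> by \<open>r\<close>
        gives \<open>z\<close>; the latter forces
        \<open>s = inv (f y) \<otimes> f z\<close>.\<close>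
      have r: "inv y \<otimes> z \<in> carrier G" using c by simp
      then obtain s where s: "s \<in> carrier G" "cj f (inv y \<otimes> z) = \<rho> s"
        using N by (metis imageE imageI)
      have "f (w \<otimes> (inv y \<otimes> z)) = f w \<otimes> s" if "w \<in> carrier G" for w
        using cj_apply[OF fB r that] s that by (simp add: \<rho>_def Bij_closed[OF fB])
      from this[OF c(1)] this[OF c(2)]
      have "f (x \<otimes> inv y \<otimes> z) = f x \<otimes> s" "f z = f y \<otimes> s"
        using c by (simp_all add: m_assoc[symmetric])
      then show ?thesis
        using c s fB by (simp add: m_assoc inv_solve_left' Bij_closed inv_solve_left)
    qed
    with fB show "f \<in> Bij (carrier G) \<and> heap_hom G f" by (simp add: heap_hom_def)
  next
    assume "f \<in> Bij (carrier G) \<and> heap_hom G f"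
    then have f: "f \<in> Bij (carrier G)" "heap_hom G f" by simp_all
    have "cj f ` carrier G \<subseteq> \<rho> ` carrier G"
      using f by (auto simp: cj_heap Bij_closed)
    moreover have "\<rho> s \<in> cj f ` carrier G" if "s \<in> carrier G" for s
    proof -
      \<comment> \<open>Surjectivity of \<open>f\<close> solves
        \<open>inv (f \<one>) \<otimes> f r = s\<close> for \<open>r\<close>, so conjugation reaches
        every right translation.\<close>
      have "f \<one> \<otimes> s \<in> carrier G" using that f by (simp add: Bij_closed)
      then obtain r where "r \<in> carrier G" "f r = f \<one> \<otimes> s"
        using Bij_image[OF f(1)] by (metis imageE)
      then have "cj f r = \<rho> s"
        using f that by (simp add: cj_heap Bij_closed m_assoc[symmetric])
      with \<open>r \<in> carrier G\<close> show ?thesis by (metis image_eqI)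
    qed
    ultimately show "f \<in> normalizer ?B ?R" using f norm_iff by blast
  qed
qed

lemma (in group) heap_antihom_inversion:
  assumes "f \<in> Bij (carrier G)"
  shows "heap_hom G (\<lambda>x\<in>carrier G. inv (f x)) \<longleftrightarrow> heap_antihom G f"
proof -
  have "inv (f (x \<otimes> inv y \<otimes> z)) = inv (f x) \<otimes> inv (inv (f y)) \<otimes> inv (f z) \<longleftrightarrow>
      f (x \<otimes> inv y \<otimes> z) = f z \<otimes> inv (f y) \<otimes> f x"
    if c: "x \<in> carrier G" "y \<in> carrier G" "z \<in> carrier G" for x y z
  proof -
    have "inv (f x) \<otimes> inv (inv (f y)) \<otimes> inv (f z) = inv (f z \<otimes> inv (f y) \<otimes> f x)"
      using c assms by (simp add: inv_mult_group Bij_closed m_assoc)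
    then show ?thesis using c assms by (simp add: Bij_closed inj_on_eq_iff[OF inv_inj])
  qed
  then show ?thesis by (simp add: heap_hom_def heap_antihom_def)
qed

text \<open>All generators are heap maps of one of the two kinds, and these form a subgroup.
  Conversely, an order-reversing \<open>f\<close> followed by inversion lies in the normalizer, so
  \<open>f\<close> is a product of two generators.\<close>

theorem (in group) D2_iff:
  "f \<in> D2 G \<longleftrightarrow> f \<in> Bij (carrier G) \<and> (heap_hom G f \<or> heap_antihom G f)"
proof
  let ?B = "BijGroup (carrier G)" and ?i = "\<lambda>x\<in>carrier G. inv x"
  let ?N = "normalizer ?B (right_translations G (carrier G))"
  let ?H = "{f \<in> Bij (carrier G). heap_hom G f \<or> heap_antihom G f}"
  have "heap_antihom G ?i"
    by (simp add: heap_antihom_def inv_mult_group m_assoc)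
  then have "?N \<union> {?i} \<subseteq> ?H"
    by (auto simp: normalizer_right_translations_iff inversion_Bij)
  then have "D2 G \<subseteq> ?H"
    unfolding D2_def by (intro group.generate_subgroup_incl[OF group_BijGroup] heap_subgroup)
  then show "f \<in> Bij (carrier G) \<and> (heap_hom G f \<or> heap_antihom G f)" if "f \<in> D2 G"
    using that by auto
  assume f: "f \<in> Bij (carrier G) \<and> (heap_hom G f \<or> heap_antihom G f)"
  then consider "heap_hom G f" | "heap_antihom G f" by blast
  then show "f \<in> D2 G"
  proof cases
    case 1
    with f show ?thesis
      by (simp add: D2_def generate.incl normalizer_right_translations_iff)
  next
    case 2
    let ?g = "\<lambda>x\<in>carrier G. inv (f x)"
    have fB: "f \<in> Bij (carrier G)" using f by simp
    have "?g = compose (carrier G) ?i f"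
      by (auto simp: compose_def Bij_closed[OF fB])
    then have gB: "?g \<in> Bij (carrier G)"
      using inversion_Bij fB by (simp add: compose_Bij)
    then have "?g \<in> ?N"
      using 2 heap_antihom_inversion[OF fB] by (simp add: normalizer_right_translations_iff)
    then have "?i \<otimes>\<^bsub>?B\<^esub> ?g \<in> D2 G"
      unfolding D2_def by (intro generate.eng generate.incl) auto
    moreover have "?i \<otimes>\<^bsub>?B\<^esub> ?g = f"
      by (rule Bij_eqI) (use gB fB inversion_Bij in \<open>auto simp: mult_BijGroup compose_Bij compose_eq Bij_closed\<close>)
    ultimately show ?thesis by simp
  qed
qed

section \<open>Almost simple groups\<close>

lemma (in group) ex_minimal_normal:
  assumes "finite (carrier G)" "N \<lhd> G" "N \<noteq> {\<one>}"
  obtains M where "minimal_normal G M" "M \<subseteq> N"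
proof -
  obtain M where M: "M \<lhd> G \<and> M \<subseteq> N \<and> M \<noteq> {\<one>}"
    and least: "\<And>M'. M' \<lhd> G \<and> M' \<subseteq> N \<and> M' \<noteq> {\<one>} \<Longrightarrow> card M \<le> card M'"
    using ex_has_least_nat[of "\<lambda>M. M \<lhd> G \<and> M \<subseteq> N \<and> M \<noteq> {\<one>}" N card] assms by auto
  have "finite M"
    using M assms(1) by (meson finite_subset normal_imp_subgroup subgroup.subset)
  then have "minimal_normal G M"
    using M least unfolding minimal_normal_def by (meson card_seteq subset_trans)
  with M that show ?thesis by blast
qed

text \<open>A minimal normal subgroup lies in the socle and is normal there, so simplicity of the
  socle leaves only one candidate.\<close>

lemma almost_simple_minimal_normal:
  assumes "almost_simple G" "minimal_normal G M"
  shows "M = socle G"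
proof -
  interpret group G using assms by (simp add: almost_simple_def)
  interpret S: simple_group "G\<lparr>carrier := socle G\<rparr>"
    using assms by (simp add: almost_simple_def)
  have "subgroup (socle G) G"
    unfolding socle_def minimal_normal_def
    by (intro generate_is_subgroup) (auto dest: normal_imp_subgroup subgroup.subset)
  moreover have "M \<subseteq> socle G"
    using assms(2) by (auto simp: socle_def intro: generate.incl)
  ultimately have "M \<lhd> G\<lparr>carrier := socle G\<rparr>"
    using assms(2) normal_restrict_supergroup by (simp add: minimal_normal_def)
  then show ?thesis
    using S.no_real_normal_subgroup assms(2) by (auto simp: minimal_normal_def)
qed

text \<open>By finiteness \<open>N\<close> contains a minimal normal subgroup, and this can only be
  the socle.\<close>

lemma almost_simple_socle_le:
  assumes "almost_simple G" "finite (carrier G)" "N \<lhd> G" "N \<noteq> {\<one>\<^bsub>G\<^esub>}"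
  shows "socle G \<subseteq> N"
  using assms group.ex_minimal_normal almost_simple_minimal_normal almost_simple_def by metis

lemma almost_simple_socle_nontrivial:
  assumes "almost_simple G" shows "socle G \<noteq> {\<one>\<^bsub>G\<^esub>}"
proof -
  interpret S: simple_group "G\<lparr>carrier := socle G\<rparr>"
    using assms by (simp add: almost_simple_def)
  show ?thesis using S.simple_not_triv by simp
qed

text \<open>Conjugation by an element of the group maps \<open>N\<close> to itself, hence also the
  set of elements commuting with all of \<open>N\<close>.\<close>

lemma (in group) centralizer_normal:
  assumes "N \<lhd> G"
  shows "{c \<in> carrier G. \<forall>l\<in>N. c \<otimes> l = l \<otimes> c} \<lhd> G" (is "?C \<lhd> G")
proof (rule normal_invI)
  interpret N: normal N G by fact
  show "subgroup ?C G"
  proof (rule subgroupI)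
    show "?C \<noteq> {}" using one_closed by fastforce
    fix c assume c: "c \<in> ?C"
    show "inv c \<in> ?C"
    proof (safe, use c in simp)
      have "c \<in> carrier G" using c by simp
      fix l assume l: "l \<in> N"
      then have "inv c \<otimes> l = inv c \<otimes> (l \<otimes> c) \<otimes> inv c"
        using c by (simp add: m_assoc)
      also have "\<dots> = inv c \<otimes> (c \<otimes> l) \<otimes> inv c" using c l by simp
      also have "\<dots> = l \<otimes> inv c" using \<open>c \<in> carrier G\<close> l by (simp add: m_assoc[symmetric])
      finally show "inv c \<otimes> l = l \<otimes> inv c" .
    qed
    fix d assume d: "d \<in> ?C"
    show "c \<otimes> d \<in> ?C"
    proof (safe, use c d in simp)
      fix l assume l: "l \<in> N"
      then have "c \<otimes> d \<otimes> l = c \<otimes> (l \<otimes> d)" using c d by (simp add: m_assoc)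
      also have "\<dots> = (l \<otimes> c) \<otimes> d" using c d l by (simp add: m_assoc[symmetric])
      finally show "c \<otimes> d \<otimes> l = l \<otimes> (c \<otimes> d)" using c d l by (simp add: m_assoc)
    qed
  qed auto
  fix g c assume g: "g \<in> carrier G" and c: "c \<in> ?C"
  show "g \<otimes> c \<otimes> inv g \<in> ?C"
  proof (safe, use c g in simp)
    fix l assume l: "l \<in> N"
    have m: "inv g \<otimes> l \<otimes> g \<in> N" using g l by (simp add: N.inv_op_closed1)
    have "g \<otimes> c \<otimes> inv g \<otimes> l = g \<otimes> (c \<otimes> (inv g \<otimes> l \<otimes> g)) \<otimes> inv g"
      using c g l by (simp add: m_assoc)
    also have "\<dots> = g \<otimes> ((inv g \<otimes> l \<otimes> g) \<otimes> c) \<otimes> inv g"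
      using c m by simp
    also have "\<dots> = l \<otimes> (g \<otimes> c \<otimes> inv g)"
      using c g l by (simp add: m_assoc[symmetric])
    finally show "g \<otimes> c \<otimes> inv g \<otimes> l = l \<otimes> (g \<otimes> c \<otimes> inv g)" .
  qed
qed

text \<open>A nontrivial \<open>c\<close> would make the centralizer of the socle a nontrivial
  normal subgroup. It would then contain the socle, which would be abelian.\<close>

lemma almost_simple_centralizer_trivial:
  fixes G (structure)
  assumes G: "almost_simple G" "finite (carrier G)" and N: "N \<lhd> G" "N \<noteq> {\<one>\<^bsub>G\<^esub>}"
    and c: "c \<in> carrier G" "\<And>l. l \<in> N \<Longrightarrow> c \<otimes>\<^bsub>G\<^esub> l = l \<otimes>\<^bsub>G\<^esub> c"
  shows "c = \<one>\<^bsub>G\<^esub>"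
proof (rule ccontr)
  interpret group G using G by (simp add: almost_simple_def)
  assume "c \<noteq> \<one>"
  obtain S where "minimal_normal G S"
    using ex_minimal_normal[OF G(2) N] by blast
  then have S: "socle G \<lhd> G"
    using almost_simple_minimal_normal[OF G(1)] by (simp add: minimal_normal_def)
  have le: "socle G \<subseteq> N" using almost_simple_socle_le[OF G N] .
  let ?C = "{c \<in> carrier G. \<forall>l\<in>socle G. c \<otimes> l = l \<otimes> c}"
  have "c \<in> ?C" using c le by blast
  then have "?C \<noteq> {\<one>}" using \<open>c \<noteq> \<one>\<close> by blast
  then have "socle G \<subseteq> ?C"
    using almost_simple_socle_le[OF G] centralizer_normal[OF S] by blast
  moreover have "group (G\<lparr>carrier := socle G\<rparr>)"
    using S by (intro subgroup_imp_group normal_imp_subgroup)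
  ultimately have "comm_group (G\<lparr>carrier := socle G\<rparr>)"
    by (intro group.group_comm_groupI) auto
  with G show False by (simp add: almost_simple_def)
qed

text \<open>The identity \<open>\<phi> l \<otimes> \<phi> x = \<phi> x \<otimes> \<phi> (x\<^sup>-\<^sup>1 l x)\<close> shows that \<open>\<phi> (x \<otimes> y)\<close> and
  \<open>\<phi> x \<otimes> \<phi> y\<close> act in the same way on \<open>L\<close> by conjugation.\<close>

lemma (in group) bimodule_map_is_mult:
  assumes L: "L \<lhd> G" and U: "subgroup U G"
    and cent: "\<And>c. c \<in> carrier G \<Longrightarrow> (\<And>l. l \<in> L \<Longrightarrow> c \<otimes> l = l \<otimes> c) \<Longrightarrow> c = \<one>"
    and closed: "\<And>x. x \<in> U \<Longrightarrow> \<phi> x \<in> carrier G"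
    and L_image: "\<phi> ` L = L" and one: "\<phi> \<one> = \<one>"
    and mult: "\<And>l x r. l \<in> L \<Longrightarrow> x \<in> U \<Longrightarrow> r \<in> L \<Longrightarrow> \<phi> (l \<otimes> x \<otimes> r) = \<phi> l \<otimes> \<phi> x \<otimes> \<phi> r"
    and x: "x \<in> U" and y: "y \<in> U"
  shows "\<phi> (x \<otimes> y) = \<phi> x \<otimes> \<phi> y"
proof -
  interpret L: normal L G by fact
  interpret U: subgroup U G by fact
  have \<phi>L: "\<phi> l \<in> carrier G" if "l \<in> L" for l
    using that L_image by (metis imageI L.mem_carrier)
  have conj: "inv u \<otimes> l \<otimes> u \<in> L" if "l \<in> L" "u \<in> U" for l u
    using that by (simp add: L.inv_op_closed1)
  have swap: "\<phi> l \<otimes> \<phi> u = \<phi> u \<otimes> \<phi> (inv u \<otimes> l \<otimes> u)" if l: "l \<in> L" and u: "u \<in> U" for l u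
  proof -
    have "\<phi> l \<otimes> \<phi> u = \<phi> (l \<otimes> u)"
      using mult[OF l u L.one_closed] one l u closed \<phi>L by simp
    also have "l \<otimes> u = u \<otimes> (inv u \<otimes> l \<otimes> u)"
      using l u by (simp add: m_assoc[symmetric])
    also have "\<phi> \<dots> = \<phi> u \<otimes> \<phi> (inv u \<otimes> l \<otimes> u)"
      using mult[OF L.one_closed u conj[OF l u]] one l u closed \<phi>L by simp
    finally show ?thesis .
  qed
  define p q where "p = \<phi> x \<otimes> \<phi> y" and "q = \<phi> (x \<otimes> y)"
  have pq: "p \<in> carrier G" "q \<in> carrier G"
    using x y closed by (simp_all add: p_def q_def)
  have "q \<otimes> inv p = \<one>"
  proof (rule cent)
    show "q \<otimes> inv p \<in> carrier G" using pq by simp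
    fix m assume "m \<in> L"
    then obtain l where l: "l \<in> L" and m: "m = \<phi> l" using L_image by blast
    have mc: "m \<in> carrier G" using l m \<phi>L by simp
    \<comment> \<open>Moving \<open>m = \<phi> l\<close> to the right past \<open>\<phi> x\<close>
      and then past \<open>\<phi> y\<close> turns it into \<open>\<phi> ?w\<close>; moving it past
      \<open>\<phi> (x \<otimes> y)\<close> in one go gives the same
      \<open>\<phi> ?w\<close>.\<close>
    let ?x = "inv x \<otimes> l \<otimes> x" and ?w = "inv (x \<otimes> y) \<otimes> l \<otimes> (x \<otimes> y)"
    have xy: "inv y \<otimes> ?x \<otimes> y = ?w"
      using l x y by (simp add: m_assoc inv_mult_group)
    have wc: "\<phi> ?w \<in> carrier G" using conj[OF l U.m_closed[OF x y]] \<phi>L by simp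
    have "m \<otimes> p = \<phi> x \<otimes> \<phi> ?x \<otimes> \<phi> y"
      using swap[OF l x] l x y closed \<phi>L by (simp add: p_def m m_assoc[symmetric])
    also have "\<dots> = \<phi> x \<otimes> (\<phi> y \<otimes> \<phi> ?w)"
      using swap[OF conj[OF l x] y] xy conj[OF l x] \<phi>L x y closed by (simp add: m_assoc)
    also have "\<dots> = p \<otimes> \<phi> ?w" using x y closed wc by (simp add: p_def m_assoc)
    finally have mp: "m \<otimes> p = p \<otimes> \<phi> ?w" .
    have mq: "m \<otimes> q = q \<otimes> \<phi> ?w"
      using swap[OF l U.m_closed[OF x y]] by (simp add: q_def m)
    have "q \<otimes> inv p \<otimes> m = q \<otimes> inv p \<otimes> (m \<otimes> p) \<otimes> inv p"
      using pq mc by (simp add: m_assoc)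
    also have "\<dots> = q \<otimes> \<phi> ?w \<otimes> inv p"
    proof -
      have "inv p \<otimes> (p \<otimes> \<phi> ?w) = \<phi> ?w"
        using pq wc by (simp add: m_assoc[symmetric])
      then show ?thesis unfolding mp using pq wc by (simp add: m_assoc)
    qed
    also have "\<dots> = m \<otimes> (q \<otimes> inv p)"
      unfolding mq[symmetric] using pq mc by (simp add: m_assoc)
    finally show "q \<otimes> inv p \<otimes> m = m \<otimes> (q \<otimes> inv p)" .
  qed
  then have "q = p" using pq by (metis inv_equality inv_inv inv_closed)
  then show ?thesis by (simp add: p_def q_def)
qed

section \<open>Blocks and linked cosets\<close>

text \<open>Restriction from \<open>W\<close> to \<open>Z\<close> respects composition because
  \<open>J\<close> preserves \<open>Z\<close>, and it is onto because restricting in two stages is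
  restricting at once. Only injectivity remains, and it is expressed here through values.\<close>

lemma restr_iso_iff:
  fixes J :: "('a \<Rightarrow> 'a) set"
  assumes J: "J \<subseteq> Bij \<Omega>" and "Z \<subseteq> W" "W \<subseteq> \<Omega>"
    and Z: "\<And>k. k \<in> J \<Longrightarrow> k ` Z = Z" and W: "\<And>k. k \<in> J \<Longrightarrow> k ` W = W"
  shows "(\<lambda>f. restrict f Z) \<in> iso (BijGroup W\<lparr>carrier := restr J W\<rparr>) (BijGroup Z\<lparr>carrier := restr J Z\<rparr>)
    \<longleftrightarrow> (\<forall>f\<in>J. \<forall>g\<in>J. (\<forall>x\<in>Z. f x = g x) \<longrightarrow> (\<forall>x\<in>W. f x = g x))"
proof -
  have Bij: "restrict k A \<in> Bij A" if "k \<in> J" "k ` A = A" "A \<subseteq> \<Omega>" for k A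
  proof -
    have "inj_on k A" using that J Bij_inj_on inj_on_subset by blast
    with that show ?thesis by (auto simp: Bij_def bij_betw_def inj_on_def)
  qed
  have ZZ: "restrict (restrict k W) Z = restrict k Z" for k :: "'a \<Rightarrow> 'a"
    using assms(2) by (simp add: Int_absorb1)
  have closed: "k x \<in> Z" if "k \<in> J" "x \<in> Z" for k x using Z that by blast
  have hom: "(\<lambda>f. restrict f Z) \<in> hom (BijGroup W\<lparr>carrier := restr J W\<rparr>) (BijGroup Z\<lparr>carrier := restr J Z\<rparr>)"
  proof (rule homI)
    fix u assume "u \<in> carrier (BijGroup W\<lparr>carrier := restr J W\<rparr>)"
    then obtain f where f: "f \<in> J" "u = restrict f W" by (auto simp: restr_def)
    then show "restrict u Z \<in> carrier (BijGroup Z\<lparr>carrier := restr J Z\<rparr>)"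
      by (simp add: ZZ restr_def del: restrict_restrict)
    fix v assume "v \<in> carrier (BijGroup W\<lparr>carrier := restr J W\<rparr>)"
    then obtain g where g: "g \<in> J" "v = restrict g W" by (auto simp: restr_def)
    have uv: "u \<in> Bij W" "v \<in> Bij W"
      using f g Bij W assms(3) by simp_all
    have Zr: "restrict u Z = restrict f Z" "restrict v Z = restrict g Z"
      using f g ZZ by simp_all
    have ZB: "restrict f Z \<in> Bij Z" "restrict g Z \<in> Bij Z"
      using Bij[OF f(1) Z[OF f(1)]] Bij[OF g(1) Z[OF g(1)]] assms(2,3) by simp_all
    have "restrict (u \<otimes>\<^bsub>BijGroup W\<^esub> v) Z = restrict f Z \<otimes>\<^bsub>BijGroup Z\<^esub> restrict g Z"
    proof
      fix x
      show "restrict (u \<otimes>\<^bsub>BijGroup W\<^esub> v) Z x = (restrict f Z \<otimes>\<^bsub>BijGroup Z\<^esub> restrict g Z) x"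
      proof (cases "x \<in> Z")
        case True
        then have "x \<in> W" "g x \<in> Z" "g x \<in> W" using closed g(1) assms(2) by auto
        with True show ?thesis
          using mult_BijGroup_apply[OF uv] mult_BijGroup_apply[OF ZB] f(2) g(2) by simp
      qed (simp add: mult_BijGroup[OF ZB] compose_def)
    qed
    then show "restrict (u \<otimes>\<^bsub>BijGroup W\<lparr>carrier := restr J W\<rparr>\<^esub> v) Z =
      restrict u Z \<otimes>\<^bsub>BijGroup Z\<lparr>carrier := restr J Z\<rparr>\<^esub> restrict v Z"
      by (simp only: Zr monoid.simps) simp
  qed
  have eq: "restrict f A = restrict g A \<longleftrightarrow> (\<forall>x\<in>A. f x = g x)" for f g :: "'a \<Rightarrow> 'a" and A
    by (metis restrict_apply' restrict_ext)
  have "bij_betw (\<lambda>f. restrict f Z) (restr J W) (restr J Z) \<longleftrightarrow> inj_on (\<lambda>f. restrict f Z) (restr J W)"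
    by (simp add: bij_betw_def restr_def image_image ZZ del: restrict_restrict)
  also have "\<dots> \<longleftrightarrow>
      (\<forall>f\<in>J. \<forall>g\<in>J. restrict f Z = restrict g Z \<longrightarrow> restrict f W = restrict g W)"
    by (simp add: inj_on_def restr_def ZZ del: restrict_restrict)
  also have "\<dots> \<longleftrightarrow> (\<forall>f\<in>J. \<forall>g\<in>J. (\<forall>x\<in>Z. f x = g x) \<longrightarrow> (\<forall>x\<in>W. f x = g x))"
    by (simp only: eq)
  finally show ?thesis using hom by (simp add: iso_def)
qed

section \<open>Permutation groups containing all left and right translations\<close>

locale star_invariant = group G for G (structure) +
  fixes K :: "('a \<Rightarrow> 'a) set"
  assumes K_subgroup: "subgroup K (BijGroup (carrier G))"
    and star_le: "star_group G (carrier G) \<subseteq> K"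
begin

lemma K_Bij: "k \<in> K \<Longrightarrow> k \<in> Bij (carrier G)"
  using subgroup.subset[OF K_subgroup] by auto

lemma K_closed: "k \<in> K \<Longrightarrow> x \<in> carrier G \<Longrightarrow> k x \<in> carrier G"
  by (rule Bij_closed[OF K_Bij])

lemma K_inj: "k \<in> K \<Longrightarrow> inj_on k (carrier G)"
  by (rule Bij_inj_on[OF K_Bij])

lemma K_compose: "k \<in> K \<Longrightarrow> k' \<in> K \<Longrightarrow> compose (carrier G) k k' \<in> K"
  using subgroup.m_closed[OF K_subgroup, of k k'] by (simp add: mult_BijGroup K_Bij)

lemma K_inverse:
  assumes "k \<in> K"
  obtains k' where "k' \<in> K" "\<And>x. x \<in> carrier G \<Longrightarrow> k' (k x) = x" "\<And>x. x \<in> carrier G \<Longrightarrow> k (k' x) = x"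
proof (rule that)
  show "inv\<^bsub>BijGroup (carrier G)\<^esub> k \<in> K"
    using subgroup.m_inv_closed[OF K_subgroup assms] .
qed (simp_all add: inv_BijGroup_left inv_BijGroup_right K_Bij assms)

text \<open>For \<open>a\<close>, \<open>b\<close> in the group these are the elements of
  \<open>star_group G (carrier G)\<close>; one family covers left translations, right translations
  and conjugations.\<close>

definition two_sided :: "'a \<Rightarrow> 'a \<Rightarrow> 'a \<Rightarrow> 'a" where
  "two_sided a b = (\<lambda>x\<in>carrier G. a \<otimes> x \<otimes> b)"

lemma two_sided_apply [simp]: "x \<in> carrier G \<Longrightarrow> two_sided a b x = a \<otimes> x \<otimes> b"
  by (simp add: two_sided_def)

lemma two_sided_in_K:
  assumes "a \<in> carrier G" "b \<in> carrier G"
  shows "two_sided a b \<in> K"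
proof -
  let ?l = "\<lambda>x\<in>carrier G. a \<otimes> x" and ?r = "\<lambda>x\<in>carrier G. x \<otimes> b"
  have "?l \<otimes>\<^bsub>BijGroup (carrier G)\<^esub> ?r \<in> star_group G (carrier G)"
    using assms unfolding star_group_def set_mult_def left_translations_def right_translations_def by blast
  also have "?l \<otimes>\<^bsub>BijGroup (carrier G)\<^esub> ?r = two_sided a b"
    using assms by (auto simp: mult_BijGroup left_translation_Bij right_translation_Bij two_sided_def
        compose_def fun_eq_iff m_assoc)
  finally show ?thesis using star_le by blast
qed

lemma block_image_eq:
  assumes "is_block (carrier G) K B" "k \<in> K" "x \<in> B" "k x \<in> B"
  shows "k ` B = B"
proof -
  have "k x \<in> k ` B \<inter> B" using assms by simp
  then show ?thesis using assms(1,2) unfolding is_block_def by (metis empty_iff)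
qed

text \<open>A member of \<open>K\<close> that keeps one point of \<open>B\<close> in
  \<open>B\<close> preserves \<open>B\<close>. Left translation by \<open>x\<close> takes
  \<open>\<one>\<close> to \<open>x\<close>, its inverse takes \<open>x\<close> to
  \<open>\<one>\<close>, and conjugations fix \<open>\<one>\<close>, so all of these preserve
  \<open>B\<close>.\<close>

lemma block_normal:
  assumes B: "is_block (carrier G) K B" and one: "\<one> \<in> B"
  shows "B \<lhd> G"
proof -
  have sub: "B \<subseteq> carrier G" using B by (simp add: is_block_def)
  have inv: "two_sided a b ` B = B"
    if "a \<in> carrier G" "b \<in> carrier G" "x \<in> B" "a \<otimes> x \<otimes> b \<in> B" for a b x
    using block_image_eq[OF B two_sided_in_K] that sub by (metis subsetD two_sided_apply)
  have left: "two_sided x \<one> ` B = B" if "x \<in> B" for x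
    using that sub one by (intro inv[of x \<one> \<one>]) auto
  have left_inv: "two_sided (inv x) \<one> ` B = B" if "x \<in> B" for x
    using that sub one by (intro inv[of "inv x" \<one> x]) auto
  have conj: "two_sided g (inv g) ` B = B" if "g \<in> carrier G" for g
    using that one by (intro inv[of g "inv g" \<one>]) auto
  show ?thesis
  proof (rule normal_invI)
    show "subgroup B G"
    proof (rule subgroupI)
      fix x assume x: "x \<in> B"
      then have "two_sided (inv x) \<one> \<one> \<in> B" using left_inv one by blast
      then show "inv x \<in> B" using x sub by auto
      fix y assume y: "y \<in> B"
      then have "two_sided x \<one> y \<in> B" using left x by blast
      moreover have "x \<in> carrier G" "y \<in> carrier G" using x y sub by auto
      ultimately show "x \<otimes> y \<in> B" by simp
    qed (use sub one in auto)
    fix g x assume "g \<in> carrier G" "x \<in> B"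
    then show "g \<otimes> x \<otimes> inv g \<in> B"
      using conj[of g] sub by (metis imageI subsetD two_sided_apply)
  qed
qed

lemma is_block_carrier: "is_block (carrier G) K (carrier G)"
  using Bij_image[OF K_Bij] one_closed by (auto simp: is_block_def)

lemma one_in_minimal_block: "\<one> \<in> minimal_block G K"
  by (simp add: minimal_block_def)

text \<open>If \<open>k\<close> keeps a point of the intersection inside it, then \<open>k\<close>
  preserves every block of the family, and injectivity lets images commute with the intersection.
  The hypothesis puts the whole group into the family, which is therefore not empty.\<close>

lemma minimal_block_is_block:
  assumes "carrier G \<noteq> {\<one>}"
  shows "is_block (carrier G) K (minimal_block G K)"
proof -
  let ?F = "{B. is_block (carrier G) K B \<and> \<one> \<in> B \<and> B \<noteq> {\<one>}}"
  have F: "carrier G \<in> ?F" using assms is_block_carrier by simp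
  have "k ` \<Inter>?F = \<Inter>?F" if k: "k \<in> K" and ne: "k ` \<Inter>?F \<inter> \<Inter>?F \<noteq> {}" for k
  proof -
    have "k ` B = B" if "B \<in> ?F" for B
      using that k ne block_image_eq by blast
    moreover have "k ` \<Inter>?F = (\<Inter>B\<in>?F. k ` B)"
      by (rule image_INT[where B = "\<lambda>B. B" and C = "carrier G", simplified, OF K_inj[OF k] _ F])
        (auto simp: is_block_def)
    ultimately show ?thesis by simp
  qed
  moreover have "\<Inter>?F \<subseteq> carrier G" using F by blast
  moreover have "\<one> \<in> \<Inter>?F" by blast
  ultimately show ?thesis
    unfolding minimal_block_def is_block_def[of _ _ "\<Inter>?F"] by (metis (no_types, lifting) empty_iff)
qed

end

text \<open>Two elements of the block \<K> that agree on one of two linked blocks agree on the other.\<close>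

locale block_section = star_invariant +
  fixes L :: "'a set"
  assumes L_block: "is_block (carrier G) K L" and L_one: "\<one> \<in> L"
begin

sublocale L: normal L G
  using block_normal[OF L_block L_one] .

abbreviation \<L> :: "'a set set" where "\<L> \<equiv> block_system K L"
abbreviation \<K> :: "('a \<Rightarrow> 'a) set" where "\<K> \<equiv> block_kernel K \<L>"

lemma image_in_system:
  assumes "Y \<in> \<L>" "k \<in> K" shows "k ` Y \<in> \<L>"
proof -
  obtain k' where k': "k' \<in> K" "Y = k' ` L" using assms(1) by (auto simp: block_system_def)
  have "k ` Y = compose (carrier G) k k' ` L"
    using k' L.subset by (auto simp: compose_def image_image cong: image_cong_simp)
  then show ?thesis using K_compose[OF assms(2) k'(1)] by (auto simp: block_system_def)
qed

text \<open>If \<open>k l = k' l'\<close>, then the inverse of \<open>k'\<close> after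
  \<open>k\<close> takes \<open>l\<close> to \<open>l'\<close>, so it preserves the block
  \<open>L\<close>.\<close>

lemma system_disjoint:
  assumes "Y \<in> \<L>" "Y' \<in> \<L>" "x \<in> Y" "x \<in> Y'"
  shows "Y = Y'"
proof -
  obtain k k' where k: "k \<in> K" "Y = k ` L" and k': "k' \<in> K" "Y' = k' ` L"
    using assms by (auto simp: block_system_def)
  obtain j where j: "j \<in> K" "\<And>x. x \<in> carrier G \<Longrightarrow> j (k' x) = x" "\<And>x. x \<in> carrier G \<Longrightarrow> k' (j x) = x"
    using K_inverse[OF k'(1)] by blast
  let ?m = "compose (carrier G) j k"
  obtain l l' where l: "l \<in> L" "l' \<in> L" "x = k l" "x = k' l'" using assms k k' by blast
  then have "?m l = l'" using j(2)[of l'] by (simp add: compose_eq)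
  then have "?m ` L = L"
    using block_image_eq[OF L_block K_compose[OF j(1) k(1)]] l by auto
  then have "k' ` L = k' ` ?m ` L" by simp
  also have "\<dots> = k ` L"
    using j(3) K_closed[OF k(1)] by (auto simp: image_image compose_eq cong: image_cong_simp)
  finally show ?thesis using k k' by simp
qed

lemma coset_in_system:
  assumes "x \<in> carrier G" shows "(\<otimes>) x ` L \<in> \<L>"
proof -
  have "(\<otimes>) x ` L = two_sided x \<one> ` L"
    using assms by (intro image_cong) auto
  then show ?thesis
    using two_sided_in_K[OF assms one_closed] unfolding block_system_def by blast
qed

lemma mem_coset: "x \<in> carrier G \<Longrightarrow> x \<in> (\<otimes>) x ` L"
  using L_one by (auto intro: image_eqI[of _ _ \<one>])

lemma coset_one: "(\<otimes>) \<one> ` L = L"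
proof -
  have "(\<otimes>) \<one> ` L = (\<lambda>x. x) ` L" by (rule image_cong) auto
  then show ?thesis by simp
qed

lemma system_subset: "Y \<in> \<L> \<Longrightarrow> Y \<subseteq> carrier G"
  using K_closed L.subset by (auto simp: block_system_def)

text \<open>The left coset of \<open>x\<close> is the image of \<open>L\<close> under a left
  translation, which lies in \<open>K\<close>, and two blocks of the system sharing \<open>x\<close>
  coincide.\<close>

lemma system_coset:
  assumes "Y \<in> \<L>" "x \<in> Y" shows "Y = (\<otimes>) x ` L"
proof -
  have "x \<in> carrier G" using assms system_subset by blast
  then show ?thesis
    using system_disjoint[OF assms(1) coset_in_system assms(2) mem_coset] by simp
qed

lemma system_nonempty: "Y \<in> \<L> \<Longrightarrow> Y \<noteq> {}"
  using L_one unfolding block_system_def by blast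

lemma kernel_K: "f \<in> \<K> \<Longrightarrow> f \<in> K"
  by (simp add: block_kernel_def)

text \<open>Blocks are left cosets \<open>y L\<close>, and normality of \<open>L\<close> lets the
  left factor \<open>a\<close> be moved across \<open>y\<close>.\<close>

lemma two_sided_in_kernel:
  assumes "a \<in> L" "b \<in> L"
  shows "two_sided a b \<in> \<K>"
proof -
  have t: "two_sided a b \<in> K" using assms by (intro two_sided_in_K) auto
  have "two_sided a b ` Y = Y" if Y: "Y \<in> \<L>" for Y
  proof -
    obtain y where y: "y \<in> Y" using system_nonempty[OF Y] by blast
    then have yc: "y \<in> carrier G" using system_subset[OF Y] by blast
    have "a \<otimes> y \<otimes> b = y \<otimes> (inv y \<otimes> a \<otimes> y \<otimes> b)"
      using assms yc by (simp add: m_assoc[symmetric])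
    moreover have "inv y \<otimes> a \<otimes> y \<otimes> b \<in> L"
      using assms yc L.inv_op_closed1 by simp
    ultimately have "two_sided a b y \<in> Y"
      using system_coset[OF Y y] yc by auto
    then show ?thesis
      using system_disjoint[OF image_in_system[OF Y t] Y] y by blast
  qed
  with t show ?thesis by (simp add: block_kernel_def)
qed

text \<open>\<open>k'\<close> permutes the blocks, \<open>f\<close> fixes each of them, and
  \<open>k\<close> carries each one back: the kernel is normalized by \<open>K\<close>.\<close>

lemma kernel_conj:
  assumes f: "f \<in> \<K>" and k: "k \<in> K" "k' \<in> K"
    and inv: "\<And>x. x \<in> carrier G \<Longrightarrow> k (k' x) = x"
  shows "compose (carrier G) k (compose (carrier G) f k') \<in> \<K>" (is "?c \<in> _")
proof -
  have "?c ` Y = Y" if Y: "Y \<in> \<L>" for Y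
  proof -
    have sub: "Y \<subseteq> carrier G" using system_subset[OF Y] .
    have "?c ` Y = k ` f ` k' ` Y"
      using sub by (auto simp: image_image compose_eq subset_iff cong: image_cong_simp)
    also have "f ` k' ` Y = k' ` Y"
      using f image_in_system[OF Y k(2)] by (simp add: block_kernel_def)
    also have "k ` k' ` Y = Y"
      using sub inv by (auto simp: image_image subset_iff cong: image_cong_simp)
    finally show ?thesis .
  qed
  then show ?thesis using f k by (simp add: block_kernel_def K_compose)
qed

text \<open>
  Restricting \<open>\<K>\<close> from the union of two blocks to one of them is always a surjective
  homomorphism, so \<^const>\<open>linked\<close> only asks for injectivity: this is \<open>tied\<close> for the cosets
  \<open>x L\<close> and \<open>y L\<close>.
\<close>

definition tied :: "'a \<Rightarrow> 'a \<Rightarrow> bool" where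
  "tied x y \<longleftrightarrow> (\<forall>f\<in>\<K>. \<forall>g\<in>\<K>.
     (\<forall>l\<in>L. f (x \<otimes> l) = g (x \<otimes> l)) \<longleftrightarrow> (\<forall>l\<in>L. f (y \<otimes> l) = g (y \<otimes> l)))"

text \<open>By \<open>restr_iso_iff\<close>, each of the two restrictions is an isomorphism iff
  agreement on one coset forces agreement on the other; together these are the two directions of
  \<open>tied\<close>.\<close>

lemma linked_iff_tied:
  assumes "x \<in> carrier G" "y \<in> carrier G"
  shows "((\<otimes>) x ` L, (\<otimes>) y ` L) \<in> linked K \<L> \<longleftrightarrow> tied x y"
proof -
  let ?Y = "(\<otimes>) x ` L" and ?Y' = "(\<otimes>) y ` L"
  have Y: "?Y \<in> \<L>" "?Y' \<in> \<L>" using assms coset_in_system by simp_all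
  have stab: "k ` Z = Z" if "Z \<in> {?Y, ?Y', ?Y \<union> ?Y'}" "k \<in> \<K>" for k Z
  proof -
    have "k ` ?Y = ?Y" "k ` ?Y' = ?Y'" using that Y unfolding block_kernel_def by blast+
    then show ?thesis using that(1) by (auto simp: image_Un)
  qed
  have "(\<lambda>f. restrict f Z) \<in> iso (BijGroup (?Y \<union> ?Y')\<lparr>carrier := restr \<K> (?Y \<union> ?Y')\<rparr>)
         (BijGroup Z\<lparr>carrier := restr \<K> Z\<rparr>)
    \<longleftrightarrow> (\<forall>f\<in>\<K>. \<forall>g\<in>\<K>. (\<forall>x\<in>Z. f x = g x) \<longrightarrow> (\<forall>x\<in>?Y \<union> ?Y'. f x = g x))"
    if Z: "Z \<in> {?Y, ?Y'}" for Z
  proof (rule restr_iso_iff)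
    show "\<K> \<subseteq> Bij (carrier G)" using kernel_K K_Bij by blast
    show "?Y \<union> ?Y' \<subseteq> carrier G" using Y system_subset by simp
    show "Z \<subseteq> ?Y \<union> ?Y'" using Z by blast
    show "k ` Z = Z" if "k \<in> \<K>" for k
      by (rule stab[OF _ that]) (use Z in auto)
    show "k ` (?Y \<union> ?Y') = ?Y \<union> ?Y'" if "k \<in> \<K>" for k
      by (rule stab[OF _ that]) simp
  qed
  note iso = this
  define E where "E Z f g \<longleftrightarrow> (\<forall>x\<in>Z. f x = g x)" for Z and f g :: "'a \<Rightarrow> 'a"
  have "(?Y, ?Y') \<in> linked K \<L> \<longleftrightarrow> (\<forall>Z\<in>{?Y, ?Y'}. \<forall>f\<in>\<K>. \<forall>g\<in>\<K>.
      E Z f g \<longrightarrow> E ?Y f g \<and> E ?Y' f g)"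
    using Y unfolding linked_def E_def ball_Un[symmetric]
    by (simp only: iso mem_Collect_eq case_prod_conv simp_thms cong: ball_cong)
  moreover have "tied x y \<longleftrightarrow> (\<forall>f\<in>\<K>. \<forall>g\<in>\<K>. E ?Y f g \<longleftrightarrow> E ?Y' f g)"
    by (simp add: tied_def E_def)
  moreover have "(\<forall>Z\<in>{?Y, ?Y'}. \<forall>f\<in>\<K>. \<forall>g\<in>\<K>.
      E Z f g \<longrightarrow> E ?Y f g \<and> E ?Y' f g) \<longleftrightarrow>
      (\<forall>f\<in>\<K>. \<forall>g\<in>\<K>. E ?Y f g \<longleftrightarrow> E ?Y' f g)"
    by blast
  ultimately show ?thesis by (simp only:)
qed

lemma tied_refl: "tied x x"
  by (simp add: tied_def)

lemma tied_sym: "tied x y \<Longrightarrow> tied y x"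
  by (simp add: tied_def)

lemma tied_trans: "tied x y \<Longrightarrow> tied y z \<Longrightarrow> tied x z"
  by (simp add: tied_def)

text \<open>Conjugating the kernel by left translation by \<open>a\<close> turns agreement on
  \<open>z L\<close> into agreement on \<open>a z L\<close>.\<close>

lemma tied_translate:
  assumes a: "a \<in> carrier G" and xy: "x \<in> carrier G" "y \<in> carrier G" and tied: "tied x y"
  shows "tied (a \<otimes> x) (a \<otimes> y)"
proof -
  define c where "c f = compose (carrier G) (two_sided (inv a) \<one>) (compose (carrier G) f (two_sided a \<one>))" for f
  have c: "c f \<in> \<K>" if "f \<in> \<K>" for f
    unfolding c_def using a that by (intro kernel_conj two_sided_in_K) (auto simp: m_assoc[symmetric])
  have eq: "(\<forall>l\<in>L. c f (z \<otimes> l) = c g (z \<otimes> l)) \<longleftrightarrow> (\<forall>l\<in>L. f (a \<otimes> z \<otimes> l) = g (a \<otimes> z \<otimes> l))"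
    if z: "z \<in> carrier G" and fg: "f \<in> \<K>" "g \<in> \<K>" for f g z
  proof -
    have "c f (z \<otimes> l) = inv a \<otimes> f (a \<otimes> z \<otimes> l)" "f (a \<otimes> z \<otimes> l) \<in> carrier G"
      if "f \<in> \<K>" "l \<in> L" for f l
      using that z a K_closed[OF kernel_K[OF that(1)]]
      by (simp_all add: c_def compose_eq m_assoc)
    then show ?thesis using fg a by simp
  qed
  show ?thesis
    unfolding tied_def
  proof (intro ballI)
    fix f g assume fg: "f \<in> \<K>" "g \<in> \<K>"
    show "(\<forall>l\<in>L. f (a \<otimes> x \<otimes> l) = g (a \<otimes> x \<otimes> l)) \<longleftrightarrow> (\<forall>l\<in>L. f (a \<otimes> y \<otimes> l) = g (a \<otimes> y \<otimes> l))"
      using tied[unfolded tied_def, rule_format, OF c[OF fg(1)] c[OF fg(2)]] eq fg xy by simp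
  qed
qed

text \<open>An elementwise description of the group \<open>U\<close> of the principal section,
  justified by \<open>Union_linked\<close> when \<open>L\<close> is the minimal block.\<close>

definition upper :: "'a set" where
  "upper = {x \<in> carrier G. tied \<one> x}"

lemma Union_linked: "\<Union>(linked K \<L> `` {L}) = upper"
proof -
  have link: "(L, (\<otimes>) x ` L) \<in> linked K \<L> \<longleftrightarrow> tied \<one> x" if "x \<in> carrier G" for x
    using linked_iff_tied[OF one_closed that] unfolding coset_one .
  show ?thesis
  proof
    show "upper \<subseteq> \<Union>(linked K \<L> `` {L})"
    proof
      fix x assume "x \<in> upper"
      then have "(L, (\<otimes>) x ` L) \<in> linked K \<L>" "x \<in> (\<otimes>) x ` L"
        using link mem_coset by (simp_all add: upper_def)
      then show "x \<in> \<Union>(linked K \<L> `` {L})" by (meson ImageI UnionI singletonI)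
    qed
    show "\<Union>(linked K \<L> `` {L}) \<subseteq> upper"
    proof
      fix x assume "x \<in> \<Union>(linked K \<L> `` {L})"
      then obtain Y where Y: "(L, Y) \<in> linked K \<L>" "x \<in> Y" by blast
      then have "Y \<in> \<L>" by (simp add: linked_def)
      then have "x \<in> carrier G" "Y = (\<otimes>) x ` L"
        using Y(2) system_subset system_coset by (meson subsetD)+
      then show "x \<in> upper" using Y(1) link[of x] by (simp add: upper_def)
    qed
  qed
qed

text \<open>Translating the relation between \<open>\<one>\<close> and \<open>x\<close> by
  \<open>inv x\<close> gives inverses; translating the one between \<open>\<one>\<close> and
  \<open>y\<close> by \<open>x\<close> gives products through transitivity.\<close>

lemma upper_subgroup: "subgroup upper G"
proof (rule subgroupI)
  show "upper \<noteq> {}" using tied_refl one_closed unfolding upper_def by blast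
  fix x assume x: "x \<in> upper"
  then show "inv x \<in> upper"
    using tied_translate[of "inv x" \<one> x] tied_sym by (auto simp: upper_def)
  fix y assume "y \<in> upper"
  with x show "x \<otimes> y \<in> upper"
    using tied_translate[of x \<one> y] tied_trans by (auto simp: upper_def)
qed (auto simp: upper_def)

text \<open>Faithfulness on \<open>L\<close> of the kernel restricted to \<open>upper\<close>:
  agreement passes from \<open>L\<close> to the coset \<open>u L\<close>, which contains
  \<open>u\<close>.\<close>

lemma kernel_eq_on_upper:
  assumes "f \<in> \<K>" "g \<in> \<K>" "\<And>l. l \<in> L \<Longrightarrow> f l = g l" "u \<in> upper"
  shows "f u = g u"
proof -
  have u: "u \<in> carrier G" "tied \<one> u" using assms(4) by (simp_all add: upper_def)
  have "\<forall>l\<in>L. f (\<one> \<otimes> l) = g (\<one> \<otimes> l)" using assms(3) by simp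
  then have "\<forall>l\<in>L. f (u \<otimes> l) = g (u \<otimes> l)"
    using u(2) assms(1,2) unfolding tied_def by blast
  then show ?thesis using L_one u(1) by (metis r_one)
qed

end

section \<open>From the action on \<open>L\<close> to the action on \<open>upper\<close>\<close>

context block_section
begin

lemma stabilizer_commutes_with_translations:
  assumes k: "k \<in> K" and kL: "k ` L = L"
    and ab: "a \<in> L" "b \<in> L" "a' \<in> L" "b' \<in> L"
    and on_L: "\<And>m. m \<in> L \<Longrightarrow> k (a \<otimes> m \<otimes> b) = a' \<otimes> k m \<otimes> b'"
    and x: "x \<in> carrier G" "k x \<in> upper"
  shows "k (a \<otimes> x \<otimes> b) = a' \<otimes> k x \<otimes> b'"
proof -
  obtain k' where k': "k' \<in> K" "\<And>x. x \<in> carrier G \<Longrightarrow> k' (k x) = x" "\<And>x. x \<in> carrier G \<Longrightarrow> k (k' x) = x"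
    using K_inverse[OF k] by blast
  \<comment> \<open>This is the conjugate of \<open>two_sided a b\<close> by \<open>k\<close>. It
    lies in the kernel and is compared with \<open>two_sided a' b'\<close>, first on
    \<open>L\<close> and then at \<open>k x\<close>.\<close>
  let ?c = "compose (carrier G) k (compose (carrier G) (two_sided a b) k')"
  have c: "?c (k z) = k (a \<otimes> z \<otimes> b)" if "z \<in> carrier G" for z
    using that k' K_closed[OF k] K_closed[OF k'(1)] by (simp add: compose_eq)
  have "?c (k x) = two_sided a' b' (k x)"
  proof (rule kernel_eq_on_upper[of ?c "two_sided a' b'" "k x"])
    show "?c \<in> \<K>" using kernel_conj[OF two_sided_in_kernel k k'(1)] ab k'(3) by simp
    show "two_sided a' b' \<in> \<K>" using ab by (simp add: two_sided_in_kernel)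
    fix l assume "l \<in> L"
    then obtain m where "m \<in> L" "l = k m" using kL by blast
    then show "?c l = two_sided a' b' l" using c on_L K_closed[OF k] by simp
  qed fact
  then show ?thesis using c x K_closed[OF k] by simp
qed

text \<open>Since \<open>k\<close> fixes \<open>\<one>\<close>, it is multiplicative or
  order-reversing on \<open>L\<close>. Both cases reduce to \<open>bimodule_map_is_mult\<close>,
  applied to \<open>k\<close> or to its composition with inversion.\<close>

lemma stabilizer_heap:
  assumes k: "k \<in> K" and one: "k \<one> = \<one>" and kU: "k ` upper = upper"
    and D: "restrict k L \<in> D2 (G\<lparr>carrier := L\<rparr>)"
    and cent: "\<And>c. c \<in> carrier G \<Longrightarrow> (\<And>l. l \<in> L \<Longrightarrow> c \<otimes> l = l \<otimes> c) \<Longrightarrow> c = \<one>"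
  shows "(\<forall>x\<in>upper. \<forall>y\<in>upper. k (x \<otimes> y) = k x \<otimes> k y) \<or>
    (\<forall>x\<in>upper. \<forall>y\<in>upper. k (x \<otimes> y) = k y \<otimes> k x)"
proof -
  interpret U: subgroup upper G by (rule upper_subgroup)
  interpret GL: group "G\<lparr>carrier := L\<rparr>"
    using subgroup_imp_group[OF L.subgroup_axioms] .
  have kL: "k ` L = L" using block_image_eq[OF L_block k L_one] one L_one by simp
  have kl: "k l \<in> L" if "l \<in> L" for l using kL that by blast
  have kc: "k x \<in> carrier G" if "x \<in> carrier G" for x using K_closed[OF k that] .
  have ku: "k x \<in> upper" if "x \<in> upper" for x using kU that by blast
  have "heap_hom (G\<lparr>carrier := L\<rparr>) (restrict k L) \<or> heap_antihom (G\<lparr>carrier := L\<rparr>) (restrict k L)"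
    using D by (simp add: GL.D2_iff)
  then show ?thesis
  proof
    assume "heap_hom (G\<lparr>carrier := L\<rparr>) (restrict k L)"
    then have mult: "k (x \<otimes> y) = k x \<otimes> k y" if "x \<in> L" "y \<in> L" for x y
      using GL.heap_hom_translate[of "restrict k L" x y] that one kl
        m_inv_consistent[OF L.subgroup_axioms] by simp
    have "k (l \<otimes> x \<otimes> r) = k l \<otimes> k x \<otimes> k r" if "l \<in> L" "x \<in> upper" "r \<in> L" for l x r
      by (rule stabilizer_commutes_with_translations[OF k kL])
        (use that in \<open>simp_all add: mult kl ku\<close>)
    then show ?thesis
      using bimodule_map_is_mult[OF L.normal_axioms upper_subgroup cent, of k] kL one kc by simp
  next
    assume "heap_antihom (G\<lparr>carrier := L\<rparr>) (restrict k L)"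
    then have mult: "k (x \<otimes> y) = k y \<otimes> k x" if "x \<in> L" "y \<in> L" for x y
      using GL.heap_antihom_translate[of "restrict k L" x y] that one kl
        m_inv_consistent[OF L.subgroup_axioms] by simp
    let ?\<phi> = "\<lambda>x. inv (k x)"
    \<comment> \<open>Order reversal exchanges the sides: the conjugated translation multiplies by
      \<open>k r\<close> on the left and by \<open>k l\<close> on the right.\<close>
    have "k (l \<otimes> x \<otimes> r) = k r \<otimes> k x \<otimes> k l" if "l \<in> L" "x \<in> upper" "r \<in> L" for l x r
      by (rule stabilizer_commutes_with_translations[OF k kL])
        (use that in \<open>simp_all add: mult kl ku kc m_assoc\<close>)
    then have "?\<phi> (l \<otimes> x \<otimes> r) = ?\<phi> l \<otimes> ?\<phi> x \<otimes> ?\<phi> r" if "l \<in> L" "x \<in> upper" "r \<in> L" for l x r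
      using that kc by (simp add: inv_mult_group m_assoc)
    moreover have "?\<phi> ` L = L"
    proof -
      have "l \<in> ?\<phi> ` L" if "l \<in> L" for l
      proof -
        have "inv l \<in> k ` L" using kL that by simp
        then obtain m where m: "inv l = k m" "m \<in> L" by (rule imageE)
        then have "l = ?\<phi> m" using that by (simp flip: m(1))
        then show ?thesis using m(2) by (rule image_eqI)
      qed
      then show ?thesis using kl by auto
    qed
    ultimately have "?\<phi> (x \<otimes> y) = ?\<phi> x \<otimes> ?\<phi> y" if "x \<in> upper" "y \<in> upper" for x y
      using bimodule_map_is_mult[OF L.normal_axioms upper_subgroup cent, of ?\<phi>] one kc that by simp
    then have "inv (k (x \<otimes> y)) = inv (k y \<otimes> k x)" if "x \<in> upper" "y \<in> upper" for x y
      using that kc by (simp add: inv_mult_group)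
    then have "k (x \<otimes> y) = k y \<otimes> k x" if "x \<in> upper" "y \<in> upper" for x y
      using that kc inj_on_eq_iff[OF inv_inj] by simp
    then show ?thesis by blast
  qed
qed

text \<open>A left translation by an element of \<open>upper\<close> turns \<open>k\<close> into a
  map \<open>h\<close> fixing \<open>\<one>\<close>, to which \<open>stabilizer_heap\<close>
  applies. The heap identity then passes from \<open>h\<close> back to \<open>k\<close>.\<close>

theorem induced_upper_le_D2:
  assumes D: "induced K L \<subseteq> D2 (G\<lparr>carrier := L\<rparr>)"
    and cent: "\<And>c. c \<in> carrier G \<Longrightarrow> (\<And>l. l \<in> L \<Longrightarrow> c \<otimes> l = l \<otimes> c) \<Longrightarrow> c = \<one>"
  shows "induced K upper \<subseteq> D2 (G\<lparr>carrier := upper\<rparr>)"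
proof
  interpret U: subgroup upper G by (rule upper_subgroup)
  interpret GU: group "G\<lparr>carrier := upper\<rparr>"
    using subgroup_imp_group[OF upper_subgroup] .
  fix f assume "f \<in> induced K upper"
  then obtain k where k: "k \<in> K" and kU: "k ` upper = upper" and f: "f = restrict k upper"
    by (auto simp: induced_def restr_def)
  have ku: "k x \<in> upper" if "x \<in> upper" for x using kU that by blast
  define u where "u = k \<one>"
  have u: "u \<in> upper" using ku by (simp add: u_def)
  define h where "h = compose (carrier G) (two_sided (inv u) \<one>) k"
  have h: "h x = inv u \<otimes> k x" if "x \<in> carrier G" for x
    using that u K_closed[OF k] by (simp add: h_def compose_eq)
  have hK: "h \<in> K" using u k by (simp add: h_def K_compose two_sided_in_K)
  have h_one: "h \<one> = \<one>" using u by (simp add: h u_def)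
  have hu: "h x \<in> upper" if "x \<in> upper" for x using that u ku by (simp add: h)
  have k_h: "k x = u \<otimes> h x" if "x \<in> upper" for x
    using that u ku by (simp add: h m_assoc[symmetric])
  have hU: "h ` upper = upper"
  proof -
    have "y \<in> h ` upper" if "y \<in> upper" for y
    proof -
      have "u \<otimes> y \<in> k ` upper" using kU u that by simp
      then obtain x where x: "u \<otimes> y = k x" "x \<in> upper" by (rule imageE)
      then have "y = h x" using that u by (simp add: h m_assoc[symmetric] flip: x(1))
      then show ?thesis using x(2) by (rule image_eqI)
    qed
    then show ?thesis using hu by blast
  qed
  \<comment> \<open>Preserving \<open>upper\<close> does not by itself say that \<open>k\<close>
    preserves \<open>L\<close>; \<open>h\<close> does because it fixes the point
    \<open>\<one>\<close> of the block.\<close>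
  have "h ` L = L" using block_image_eq[OF L_block hK L_one] h_one L_one by simp
  then have "restrict h L \<in> D2 (G\<lparr>carrier := L\<rparr>)"
    using D hK by (auto simp: induced_def restr_def)
  note heap = stabilizer_heap[OF hK h_one hU this cent]
  have "f \<in> Bij upper"
    using kU K_inj[OF k] inj_on_subset[of k _ upper] U.subset f
    by (auto simp: Bij_def bij_betw_def inj_on_restrict_eq)
  moreover have "heap_hom (G\<lparr>carrier := upper\<rparr>) f \<or> heap_antihom (G\<lparr>carrier := upper\<rparr>) f"
    using heap
  proof
    assume "\<forall>x\<in>upper. \<forall>y\<in>upper. h (x \<otimes> y) = h x \<otimes> h y"
    then have mult: "h (x \<otimes> y) = h x \<otimes> h y" if "x \<in> upper" "y \<in> upper" for x y using that by blast
    have inv: "h (inv x) = inv (h x)" if "x \<in> upper" for x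
      using mult[of "inv x" x] that h_one hu by (simp add: inv_equality)
    \<comment> \<open>With \<open>k x = u \<otimes> h x\<close>, the factor \<open>inv u\<close>
      from the inverted middle term cancels against the \<open>u\<close> of the last term, leaving a
      single \<open>u\<close> in front.\<close>
    show ?thesis
      using u hu ku by (simp add: heap_hom_def f k_h mult inv m_inv_consistent[OF upper_subgroup]
          inv_mult_group m_assoc) (simp add: m_assoc[symmetric])
  next
    assume "\<forall>x\<in>upper. \<forall>y\<in>upper. h (x \<otimes> y) = h y \<otimes> h x"
    then have mult: "h (x \<otimes> y) = h y \<otimes> h x" if "x \<in> upper" "y \<in> upper" for x y using that by blast
    have inv: "h (inv x) = inv (h x)" if "x \<in> upper" for x
      using mult[of x "inv x"] that h_one hu by (simp add: inv_equality)
    show ?thesis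
      using u hu ku by (simp add: heap_antihom_def f k_h mult inv m_inv_consistent[OF upper_subgroup]
          inv_mult_group m_assoc) (simp add: m_assoc[symmetric])
  qed
  ultimately show "f \<in> D2 (G\<lparr>carrier := upper\<rparr>)" by (simp add: GU.D2_iff)
qed

end

text \<open>Every block in the defining intersection is a nontrivial normal subgroup, so it contains
  the socle, which is itself nontrivial.\<close>

lemma almost_simple_minimal_block_nontrivial:
  assumes "almost_simple G" "finite (carrier G)" "star_invariant G K"
  shows "minimal_block G K \<noteq> {\<one>\<^bsub>G\<^esub>}"
proof -
  interpret star_invariant G K by fact
  have "socle G \<subseteq> minimal_block G K"
    unfolding minimal_block_def
    using almost_simple_socle_le[OF assms(1,2)] block_normal by blast
  moreover have "\<one>\<^bsub>G\<^esub> \<in> socle G" by (simp add: socle_def generate.one)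
  ultimately show ?thesis using almost_simple_socle_nontrivial[OF assms(1)] by blast
qed

theorem theorem6p3:
  fixes G :: "('a, 'b) monoid_scheme"
    and K :: "('a \<Rightarrow> 'a) set"
    and U :: "'a set"
  assumes "finite (carrier G)"
    and "almost_simple G"
    and "subgroup K (BijGroup (carrier G))"
    and "two_closed (carrier G) K"
    and "star_group G (carrier G) \<subseteq> K"
    and "normal_type G K"
    and "U = principal_upper G K"
  shows "induced K U \<subseteq> D2 (G\<lparr>carrier := U\<rparr>)"
proof -
  let ?L = "minimal_block G K"
  interpret group G using assms(2) by (simp add: almost_simple_def)
  interpret star_invariant G K
    using assms(3,5) is_group by (intro star_invariant.intro star_invariant_axioms.intro)
  have nontrivial: "?L \<noteq> {\<one>\<^bsub>G\<^esub>}"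
    using almost_simple_minimal_block_nontrivial[OF assms(2,1)] star_invariant_axioms by blast
  \<comment> \<open>In a trivial group no block would qualify, and \<open>minimal_block\<close>
    would be an intersection over the empty family.\<close>
  have "carrier G \<noteq> {\<one>\<^bsub>G\<^esub>}"
  proof
    assume "carrier G = {\<one>\<^bsub>G\<^esub>}"
    moreover have "socle G \<subseteq> carrier G"
      unfolding socle_def minimal_normal_def
      by (intro generate_incl) (auto dest: normal_imp_subgroup subgroup.subset)
    moreover have "\<one>\<^bsub>G\<^esub> \<in> socle G" by (simp add: socle_def generate.one)
    ultimately show False using almost_simple_socle_nontrivial[OF assms(2)] by blast
  qed
  then interpret block_section G K ?L
    using minimal_block_is_block one_in_minimal_block star_invariant_axioms
    by (intro block_section.intro block_section_axioms.intro)
  have "U = upper"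
    using assms(7) Union_linked by (simp add: principal_upper_def)
  moreover have "induced K ?L \<subseteq> D2 (G\<lparr>carrier := ?L\<rparr>)"
    using assms(6) by (simp add: normal_type_def Let_def)
  \<comment> \<open>The minimal block is a nontrivial normal subgroup, so its centralizer is
    trivial, as the general statement requires.\<close>
  ultimately show ?thesis
    using induced_upper_le_D2
      almost_simple_centralizer_trivial[OF assms(2,1) L.normal_axioms nontrivial] by simp
qed

end
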